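(* Let $f:\mathbb{D}\to\widehat{\mathbb{C}}$ be a spherically convex function. Then $$L_s f(r\mathbb{T})\le\frac{2\pi r}{1-r^2}\,f^{\sharp}(0)\quad\text{for every } 0<r<1.$$
   Context: $\mathbb{D}=\{z\in\mathbb{C}:|z|<1\}$, $\mathbb{T}=\partial\mathbb{D}$, $r\mathbb{T}=\{|z|=r\}$; $\widehat{\mathbb{C}}=\mathbb{C}\cup\{\infty\}$ is the Riemann sphere with the spherical metric $\frac{|dz|}{1+|z|^2}$ (Gaussian curvature $+4$). For two non-antipodal points $a,b\in\widehat{\mathbb{C}}$, the spherical geodesic joining them is the smaller arc of the great circle through $a$ and $b$. A domain $\Omega\subset\widehat{\mathbb{C}}$ is spherically convex if for any two points $a,b\in\Omega$ that are not antipodal the spherical geodesic joining $a$ and $b$ lies in $\Omega$. A meromorphic univalent (injective) map $f:\mathbb{D}\to\widehat{\mathbb{C}}$ is called spherically convex if $f(\mathbb{D})$ is a spherically convex domain. The spherical derivative is $f^{\sharp}(z)=\frac{|f'(z)|}{1+|f(z)|^2}$ (at a pole of $f$ defined by continuous extension), and $$L_s f(r\mathbb{T})=\int_{r\mathbb{T}}f^{\sharp}(z)\,|dz|.$$ *)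

theory Defs
  imports "HOL-Complex_Analysis.Complex_Analysis"
begin

section \<open>The Riemann sphere\<close>

datatype riemann_sphere = Finite_pt complex | Infinity_pt

text \<open>
  Inverse stereographic projection onto the unit sphere. Up to the constant factor 2 it is an
  isometry from the metric |dz| / (1 + |z|^2) to the round metric, so it identifies antipodal
  points, great circles and arcs; the topology of the Riemann sphere is transported along it, too.
\<close>
fun stereographic :: "riemann_sphere \<Rightarrow> complex \<times> real" where
  "stereographic (Finite_pt z) =
     ((2 / complex_of_real (1 + (cmod z)\<^sup>2)) * z, ((cmod z)\<^sup>2 - 1) / (1 + (cmod z)\<^sup>2))"
| "stereographic Infinity_pt = (0, 1)"

definition antipodal :: "riemann_sphere \<Rightarrow> riemann_sphere \<Rightarrow> bool" where
  "antipodal a b \<longleftrightarrow> stereographic b = - stereographic a"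

text \<open>
  For unit vectors p and q with q \<noteq> -p the great circle through p and q is the intersection of
  the unit sphere with the plane they span, and its smaller arc from p to q is the part in the
  convex cone over p and q, see \<open>minor_arc_eq\<close> (for p = q the arc is a single point).
\<close>
definition minor_arc :: "'a::real_inner \<Rightarrow> 'a \<Rightarrow> 'a set" where
  "minor_arc p q = {x \<in> sphere 0 1. \<exists>s\<ge>0. \<exists>t\<ge>0. x = s *\<^sub>R p + t *\<^sub>R q}"

lemma minor_arc_eq:
  fixes p u :: "'a::real_inner"
  assumes p: "norm p = 1" and u: "norm u = 1" and pu: "p \<bullet> u = 0"
    and \<theta>: "0 \<le> \<theta>" "\<theta> < pi"
  shows "minor_arc p (cos \<theta> *\<^sub>R p + sin \<theta> *\<^sub>R u) = (\<lambda>\<phi>. cos \<phi> *\<^sub>R p + sin \<phi> *\<^sub>R u) ` {0..\<theta>}"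
    (is "minor_arc p ?q = ?c ` _")
proof (cases "\<theta> = 0")
  case True
  have "\<exists>s\<ge>0. \<exists>t\<ge>0. p = s *\<^sub>R p + t *\<^sub>R p"
    by (rule exI[of _ 1], simp, rule exI[of _ 0], simp)
  then have "p \<in> minor_arc p p"
    unfolding minor_arc_def using p by simp
  moreover have "x = p" if "x \<in> minor_arc p p" for x
  proof -
    have nx: "norm x = 1" and "\<exists>s\<ge>0. \<exists>t\<ge>0. x = s *\<^sub>R p + t *\<^sub>R p"
      using that by (simp_all add: minor_arc_def)
    then obtain s t where st: "0 \<le> s" "0 \<le> t" and x': "x = s *\<^sub>R p + t *\<^sub>R p"
      by (elim exE conjE)
    have x: "x = (s + t) *\<^sub>R p"
      unfolding x' by (simp add: scaleR_add_left)
    with st nx have "\<bar>s + t\<bar> = 1"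
      using p by simp
    with st have "s + t = 1"
      by simp
    then show ?thesis
      using x by simp
  qed
  ultimately have "minor_arc p p = {p}"
    by auto
  then show ?thesis
    using True by simp
next
  case False
  then have \<theta>0: "0 < \<theta>" and s\<theta>: "0 < sin \<theta>"
    using \<theta> sin_gt_zero by auto
  have norm2: "(norm (a *\<^sub>R p + b *\<^sub>R u))\<^sup>2 = a\<^sup>2 + b\<^sup>2" for a b :: real
  proof -
    have "p \<bullet> p = 1" "u \<bullet> u = 1" "u \<bullet> p = 0"
      using p u pu by (simp_all add: norm_eq_1 inner_commute)
    then show ?thesis
      unfolding power2_norm_eq_inner
      by (simp add: inner_add_left inner_add_right pu power2_eq_square)
  qed
  show ?thesis
  proof (intro set_eqI iffI)
    fix x assume "x \<in> minor_arc p ?q"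
    then have "norm x = 1" and "\<exists>s\<ge>0. \<exists>t\<ge>0. x = s *\<^sub>R p + t *\<^sub>R ?q"
      by (simp_all add: minor_arc_def)
    then obtain s t where st: "0 \<le> s" "0 \<le> t" and x: "x = s *\<^sub>R p + t *\<^sub>R ?q"
      by (elim exE conjE)
    have x': "x = (s + t * cos \<theta>) *\<^sub>R p + (t * sin \<theta>) *\<^sub>R u"
      unfolding x by (simp add: algebra_simps)
    have "(s + t * cos \<theta>)\<^sup>2 + (t * sin \<theta>)\<^sup>2 = 1"
      using norm2[of "s + t * cos \<theta>" "t * sin \<theta>"] \<open>norm x = 1\<close> x' by simp
    moreover have "0 \<le> t * sin \<theta>"
      using st s\<theta> by simp
    ultimately obtain \<phi> where \<phi>: "0 \<le> \<phi>" "\<phi> \<le> pi" "s + t * cos \<theta> = cos \<phi>" "t * sin \<theta> = sin \<phi>"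
      using sincos_total_pi by blast
    have "s * sin \<theta> = sin (\<theta> - \<phi>)"
      unfolding sin_diff \<phi>(3,4)[symmetric] by (simp add: algebra_simps)
    then have "0 \<le> sin (\<theta> - \<phi>)"
      using st s\<theta> by (metis less_imp_le mult_nonneg_nonneg)
    have "\<phi> \<le> \<theta>"
    proof (rule ccontr)
      assume "\<not> \<phi> \<le> \<theta>"
      then have "0 < sin (\<phi> - \<theta>)"
        using \<phi> \<theta>0 by (intro sin_gt_zero) auto
      with \<open>0 \<le> sin (\<theta> - \<phi>)\<close> show False
        using sin_minus[of "\<theta> - \<phi>"] by simp
    qed
    then show "x \<in> ?c ` {0..\<theta>}"
      using x' \<phi> by auto
  next
    fix x assume "x \<in> ?c ` {0..\<theta>}"
    then obtain \<phi> where \<phi>: "0 \<le> \<phi>" "\<phi> \<le> \<theta>" and x: "x = ?c \<phi>"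
      by auto
    define s t where "s = sin (\<theta> - \<phi>) / sin \<theta>" and "t = sin \<phi> / sin \<theta>"
    have "0 \<le> s" "0 \<le> t"
      using \<phi> \<theta> s\<theta> by (auto simp: s_def t_def intro!: divide_nonneg_pos sin_ge_zero)
    moreover have "t * sin \<theta> = sin \<phi>" "s + t * cos \<theta> = cos \<phi>"
      using s\<theta> by (simp_all add: s_def t_def sin_diff field_simps)
    then have "x = (s + t * cos \<theta>) *\<^sub>R p + (t * sin \<theta>) *\<^sub>R u"
      unfolding x by (simp only:)
    then have "x = s *\<^sub>R p + t *\<^sub>R ?q"
      by (simp add: algebra_simps)
    moreover have "norm x = 1"
      using norm2[of "cos \<phi>" "sin \<phi>"] unfolding x
      by (intro power2_eq_imp_eq[of _ 1]) simp_all
    ultimately show "x \<in> minor_arc p ?q"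
      unfolding minor_arc_def mem_Collect_eq mem_sphere_0 by (intro conjI exI)
  qed
qed

definition spherical_geodesic :: "riemann_sphere \<Rightarrow> riemann_sphere \<Rightarrow> riemann_sphere set" where
  "spherical_geodesic a b =
     {c. stereographic c \<in> minor_arc (stereographic a) (stereographic b)}"

definition sphere_domain :: "riemann_sphere set \<Rightarrow> bool" where
  "sphere_domain \<Omega> \<longleftrightarrow> \<Omega> \<noteq> {} \<and> openin (top_of_set (sphere 0 1)) (stereographic ` \<Omega>) \<and>
     connected (stereographic ` \<Omega>)"

definition spherically_convex :: "riemann_sphere set \<Rightarrow> bool" where
  "spherically_convex \<Omega> \<longleftrightarrow> sphere_domain \<Omega> \<and>
     (\<forall>a\<in>\<Omega>. \<forall>b\<in>\<Omega>. \<not> antipodal a b \<longrightarrow> spherical_geodesic a b \<subseteq> \<Omega>)"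


section \<open>Spherically convex functions\<close>

text \<open>
  A meromorphic function is given by a nicely meromorphic complex function, whose only
  discontinuities are poles; a pole is mapped to infinity (the library's value 0 of such a function
  at a pole is a mere convention).
\<close>
definition sphere_map :: "(complex \<Rightarrow> complex) \<Rightarrow> complex \<Rightarrow> riemann_sphere" where
  "sphere_map f z = (if is_pole f z then Infinity_pt else Finite_pt (f z))"

definition spherically_convex_fun :: "(complex \<Rightarrow> complex) \<Rightarrow> bool" where
  "spherically_convex_fun f \<longleftrightarrow> f nicely_meromorphic_on ball 0 1 \<and>
     inj_on (sphere_map f) (ball 0 1) \<and> spherically_convex (sphere_map f ` ball 0 1)"

definition spherical_deriv :: "(complex \<Rightarrow> complex) \<Rightarrow> complex \<Rightarrow> real" where
  "spherical_deriv f z =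
     (if is_pole f z then Lim (at z) (\<lambda>w. cmod (deriv f w) / (1 + (cmod (f w))\<^sup>2))
      else cmod (deriv f z) / (1 + (cmod (f z))\<^sup>2))"

definition spherical_length :: "(complex \<Rightarrow> complex) \<Rightarrow> (real \<Rightarrow> complex) \<Rightarrow> real" where
  "spherical_length f \<gamma> =
     integral {0..1} (\<lambda>t. spherical_deriv f (\<gamma> t) * cmod (vector_derivative \<gamma> (at t within {0..1})))"

end

theory Submission
  imports Defs
begin

text \<open>
  The spherical problem reduces to a Euclidean one. Both sides of the inequality are invariant under
  rotations of the sphere, so let \<open>f 0 = 0\<close>. Then \<open>f\<close> omits \<open>\<infinity>\<close> and its image is a convex plane
  domain. Indeed, a spherically convex domain that contains two antipodal points is the whole sphere
  (\<open>spherically_convex_antipodal_imp_UNIV\<close>), which by Liouville's theorem is not a univalent image of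
  the disc (\<open>sphere_map_disc_not_surj\<close>); and for \<open>a, b\<close> in the image, the Euclidean segment from
  \<open>a\<close> to \<open>b\<close> lies in the spherical triangle with vertices \<open>a\<close>, \<open>b\<close> and \<open>0\<close>
  (\<open>stereographic_segment\<close>, \<open>convex_rotated_domain\<close>). Finally \<open>f\<^sup># \<le> |f'|\<close>, with
  equality at \<open>0\<close> because \<open>f 0 = 0\<close>, so it is enough to bound the mean of \<open>|f'|\<close> over the circle
  by \<open>|f'(0)| / (1 - r\<^sup>2)\<close>.

  For a univalent map \<open>g\<close> onto a convex domain this bound comes from averaging
  (\<open>mean_norm_deriv_le_of_convex_image\<close>). Let \<open>\<psi>\<^sub>t\<close> be the disc automorphism that sends \<open>0\<close> to
  \<open>r e\<^sup>i\<^sup>t\<close> and is precomposed with that rotation of the disc which makes \<open>(g \<circ> \<psi>\<^sub>t)'(0)\<close> positive, and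
  let \<open>G\<close> be the mean of \<open>g \<circ> \<psi>\<^sub>t\<close> over \<open>t\<close>. By convexity \<open>G\<close> maps the disc into the image of \<open>g\<close>;
  by the mean value property \<open>G 0 = g 0\<close>; and \<open>G'(0)\<close> is \<open>1 - r\<^sup>2\<close> times the mean of \<open>|g'|\<close>. The
  Schwarz lemma for \<open>g\<^sup>-\<^sup>1 \<circ> G\<close> gives \<open>|G'(0)| \<le> |g'(0)|\<close>.
\<close>

section \<open>The mean of the derivative of a univalent map onto a convex domain\<close>

text \<open>
  The convex hull of the values is compact; a hyperplane strictly separating it from the mean would
  contradict monotonicity of the integral.
\<close>
lemma integral_mem_convex:
  fixes \<phi> :: "real \<Rightarrow> 'a::euclidean_space"
  assumes cont: "continuous_on {0..1} \<phi>" and S: "convex S" "\<phi> ` {0..1} \<subseteq> S"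
  shows "integral {0..1} \<phi> \<in> S"
proof -
  define K where "K = convex hull (\<phi> ` {0..1})"
  have "compact K"
    unfolding K_def by (intro compact_convex_hull compact_continuous_image cont compact_Icc)
  then have "closed K"
    by (rule compact_imp_closed)
  have \<phi>K: "\<phi> t \<in> K" if "t \<in> {0..1}" for t
    unfolding K_def using that by (intro hull_inc) auto
  have int: "\<phi> integrable_on {0..1}"
    using cont by (rule integrable_continuous_real)
  have "integral {0..1} \<phi> \<in> K"
  proof (rule ccontr)
    assume "integral {0..1} \<phi> \<notin> K"
    then obtain a b where a: "a \<bullet> integral {0..1} \<phi> < b" and b: "\<And>x. x \<in> K \<Longrightarrow> b < a \<bullet> x"
      using separating_hyperplane_closed_point[OF _ \<open>closed K\<close>] by (metis K_def convex_convex_hull)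
    have "integral {0..1} (\<lambda>t. a \<bullet> \<phi> t) = a \<bullet> integral {0..1} \<phi>"
      using integral_linear[OF int bounded_linear_inner_right[of a]] by (simp add: o_def)
    moreover have "(\<lambda>t. a \<bullet> \<phi> t) integrable_on {0..1}"
      by (intro integrable_continuous_real continuous_intros cont)
    then have "integral {0..1} (\<lambda>t::real. b) \<le> integral {0..1} (\<lambda>t. a \<bullet> \<phi> t)"
      by (intro integral_le) (auto intro!: less_imp_le[OF b] \<phi>K)
    ultimately show False
      using a by simp
  qed
  then show ?thesis
    using hull_minimal[OF S(2), of convex] S(1) unfolding K_def by blast
qed

lemma circle_mean_value:
  assumes g: "g holomorphic_on ball 0 1" and r: "0 < r" "r < 1"
  shows "integral {0..1} (\<lambda>t. g (circlepath 0 r t)) = g 0"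
proof -
  have "g holomorphic_on cball 0 r"
    using r by (intro holomorphic_on_subset[OF g]) auto
  then have "((\<lambda>u. g u / (u - 0)) has_contour_integral 2 * of_real pi * \<i> * g 0) (circlepath 0 r)"
    using r by (intro Cauchy_integral_circlepath_simple) auto
  then have "((\<lambda>t. 2 * of_real pi * \<i> * g (circlepath 0 r t)) has_integral 2 * of_real pi * \<i> * g 0) {0..1}"
    unfolding has_contour_integral_def
    using r by (elim has_integral_eq[rotated]) (simp add: vector_derivative_circlepath01, simp add: circlepath)
  from has_integral_mult_right[OF this, of "1 / (2 * of_real pi * \<i>)"]
  have "((\<lambda>t. g (circlepath 0 r t)) has_integral g 0) {0..1}"
    by simp
  then show ?thesis
    by (rule integral_unique)
qed

text \<open>
  Equality holds for \<open>g z = z / (1 - z)\<close>, which maps the disc onto a half-plane.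
\<close>
lemma mean_norm_deriv_le_of_convex_image:
  assumes g: "g holomorphic_on ball 0 1" and inj: "inj_on g (ball 0 1)"
    and conv: "convex (g ` ball 0 1)" and r: "0 < r" "r < 1"
  shows "(1 - r\<^sup>2) * integral {0..1} (\<lambda>t. cmod (deriv g (circlepath 0 r t))) \<le> cmod (deriv g 0)"
proof -
  let ?D = "ball (0::complex) 1"
  define w where "w = circlepath 0 r"
  \<comment> \<open>The unimodular factor \<open>c t\<close> turns the derivative of \<open>\<lambda>z. g (m z t)\<close> at \<open>0\<close> into a positive number.\<close>
  define c where "c t = of_real (cmod (deriv g (w t))) / deriv g (w t)" for t
  define m where "m z t = Moebius_function 0 (- w t) (c t * z)" for z t
  define m' where "m' z t = c t * of_real (1 - r\<^sup>2) / (1 + cnj (w t) * (c t * z))\<^sup>2" for z t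
  define G where "G z = integral {0..1} (\<lambda>t. g (m z t))" for z
  have w: "cmod (w t) = r" for t
    using r by (simp add: w_def circlepath norm_mult)
  have wD: "w t \<in> ?D" for t
    using w r by simp
  have nz: "deriv g z \<noteq> 0" if "z \<in> ?D" for z
    using holomorphic_injective_imp_regular[OF g _ inj that] by simp
  have c: "cmod (c t) = 1" for t
    using nz[OF wD] by (simp add: c_def norm_divide)
  have mD: "m z t \<in> ?D" if "z \<in> ?D" for z t
    unfolding m_def using that w c r by (auto simp: norm_mult intro!: Moebius_function_norm_lt_1)
  have den: "1 + cnj (w t) * (c t * z) \<noteq> 0" if "z \<in> ?D" for z t
  proof -
    have "cmod (cnj (w t) * (c t * z)) < 1"
      using that r norm_mult_less[of "cnj (w t)" 1 "c t * z" 1] by (simp add: norm_mult w c)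
    then show ?thesis
      by (metis add_eq_0_iff norm_minus_cancel norm_one less_irrefl)
  qed
  have m_eq: "m z t = (c t * z + w t) / (1 + cnj (w t) * (c t * z))" for z t
    by (simp add: m_def Moebius_function_simple)
  have m0: "m 0 t = w t" "m' 0 t = c t * of_real (1 - r\<^sup>2)" for t
    by (simp_all add: m_eq m'_def)
  have m_deriv: "((\<lambda>z. m z t) has_field_derivative m' z t) (at z)" if "z \<in> ?D" for z t
  proof -
    have "cnj (w t) * w t = of_real (r\<^sup>2)"
      using complex_norm_square[of "w t"] w[of t] by (simp add: mult.commute)
    then show ?thesis
      unfolding m_eq m'_def using den[OF that, of t]
      by (auto intro!: derivative_eq_intros simp: power2_eq_square) (simp add: algebra_simps)
  qed
  have g': "(g has_field_derivative deriv g z) (at z)" if "z \<in> ?D" for z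
    using holomorphic_derivI[OF g _ that] by simp
  have gm_deriv: "((\<lambda>z. g (m z t)) has_field_derivative deriv g (m z t) * m' z t) (at z within ?D)"
    if "z \<in> ?D" for z t
    using DERIV_chain2[OF g'[OF mD[OF that]] m_deriv[OF that]] by (rule DERIV_subset) simp
  have cont_g: "continuous_on ?D g" and cont_g': "continuous_on ?D (deriv g)"
    using g holomorphic_on_imp_continuous_on holomorphic_deriv by blast+
  have cont_w: "continuous_on A w" for A
    unfolding w_def circlepath by (intro continuous_intros)
  have cont_c: "continuous_on A c" for A
    unfolding c_def using nz[OF wD] wD
    by (auto intro!: continuous_intros continuous_on_compose2[OF cont_g'] cont_w)
  have cont_m: "continuous_on (?D \<times> {0..1}) (\<lambda>p. m (fst p) (snd p))"
    unfolding m_eq using den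
    by (auto intro!: continuous_intros continuous_on_compose2[OF cont_w[of UNIV]] continuous_on_compose2[OF cont_c[of UNIV]])
  have cont_m': "continuous_on (?D \<times> {0..1}) (\<lambda>p. m' (fst p) (snd p))"
    unfolding m'_def using den
    by (auto intro!: continuous_intros continuous_on_compose2[OF cont_w[of UNIV]] continuous_on_compose2[OF cont_c[of UNIV]])
  have cont_gm': "continuous_on (?D \<times> cbox 0 1) (\<lambda>(z, t). deriv g (m z t) * m' z t)"
    unfolding split_beta box_real using mD
    by (auto intro!: continuous_intros cont_m cont_m' continuous_on_compose2[OF cont_g'])
  have cont_gm: "continuous_on {0..1} (\<lambda>t. g (m z t))" if "z \<in> ?D" for z
  proof -
    have "continuous_on {0..1} (\<lambda>t. m z t)"
      using that by (intro continuous_on_compose2[OF cont_m, of _ "\<lambda>t. (z, t)", simplified] continuous_intros) auto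
    then show ?thesis
      using mD[OF that] by (intro continuous_on_compose2[OF cont_g]) auto
  qed
  have int_gm: "(\<lambda>t. g (m z t)) integrable_on cbox 0 1" if "z \<in> ?D" for z
    using cont_gm[OF that] by (simp add: integrable_continuous_real)
  have G_hol: "G holomorphic_on ?D"
    unfolding G_def using leibniz_rule_holomorphic[OF gm_deriv int_gm cont_gm'] by simp
  define I where "I = integral {0..1} (\<lambda>t. cmod (deriv g (w t)))"
  have int_g': "(\<lambda>t. cmod (deriv g (w t))) integrable_on {0..1}"
    using wD by (auto intro!: integrable_continuous_real continuous_intros continuous_on_compose2[OF cont_g'] cont_w)
  have "deriv g (m 0 t) * m' 0 t = of_real ((1 - r\<^sup>2) * cmod (deriv g (w t)))" for t
    using nz[OF wD, of t] by (simp add: m0 c_def)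
  moreover have "((\<lambda>t. complex_of_real ((1 - r\<^sup>2) * cmod (deriv g (w t)))) has_integral of_real ((1 - r\<^sup>2) * I)) {0..1}"
    unfolding I_def by (intro has_integral_of_real has_integral_mult_right integrable_integral int_g')
  ultimately have "integral (cbox 0 1) (\<lambda>t. deriv g (m 0 t) * m' 0 t) = of_real ((1 - r\<^sup>2) * I)"
    by (simp only: box_real integral_unique)
  moreover have "(G has_field_derivative integral (cbox 0 1) (\<lambda>t. deriv g (m 0 t) * m' 0 t)) (at 0 within ?D)"
    unfolding G_def using leibniz_rule_field_derivative[OF gm_deriv int_gm cont_gm', of 0] by simp
  ultimately have G': "(G has_field_derivative of_real ((1 - r\<^sup>2) * I)) (at 0)"
    using at_within_open[of "0::complex" ?D] by simp
  have G_mem: "G z \<in> g ` ?D" if "z \<in> ?D" for z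
    unfolding G_def using mD[OF that] by (intro integral_mem_convex cont_gm that conv) auto
  have G0: "G 0 = g 0"
    unfolding G_def m0 w_def using g r by (rule circle_mean_value)
  obtain k where k: "k holomorphic_on g ` ?D"
    "\<And>z. z \<in> ?D \<Longrightarrow> deriv g z * deriv k (g z) = 1" "\<And>z. z \<in> ?D \<Longrightarrow> k (g z) = z"
    using holomorphic_has_inverse[OF g _ inj] by auto
  have "open (g ` ?D)"
    using open_mapping_thm3[OF g _ inj] by simp
  have "(\<lambda>z. k (G z)) holomorphic_on ?D"
    using holomorphic_on_compose_gen[OF G_hol k(1)] G_mem unfolding o_def by blast
  then have "cmod (deriv (\<lambda>z. k (G z)) 0) \<le> 1"
    by (rule Schwarz_Lemma(2)[where \<xi> = 0]) (use G0 k(3) G_mem in force)+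
  moreover have "((\<lambda>z. k (G z)) has_field_derivative deriv k (g 0) * deriv G 0) (at 0)"
    using DERIV_chain2[of k _ "G" 0 "deriv G 0"] holomorphic_derivI[OF k(1) \<open>open (g ` ?D)\<close>, of "g 0"]
      DERIV_deriv_iff_has_field_derivative G' G0 by (metis centre_in_ball imageI zero_less_one DERIV_imp_deriv)
  ultimately have "cmod (deriv k (g 0) * deriv G 0) \<le> 1"
    by (simp add: DERIV_imp_deriv)
  moreover have "cmod (deriv g 0) * cmod (deriv k (g 0)) = 1"
    using k(2)[of 0] by (metis centre_in_ball norm_mult norm_one zero_less_one)
  ultimately have "cmod (deriv G 0) \<le> cmod (deriv g 0)"
    by (simp add: norm_mult) (metis mult_left_mono mult.assoc mult.right_neutral mult_1 norm_ge_zero)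
  then have "cmod (of_real ((1 - r\<^sup>2) * I)) \<le> cmod (deriv g 0)"
    by (simp only: DERIV_imp_deriv[OF G'])
  then have "\<bar>(1 - r\<^sup>2) * I\<bar> \<le> cmod (deriv g 0)"
    by (simp only: norm_of_real)
  then show ?thesis
    unfolding I_def w_def by linarith
qed

section \<open>Spherically convex sets in the unit sphere\<close>

lemma norm_stereographic: "norm (stereographic x) = 1"
proof (cases x)
  case (Finite_pt z)
  define n where "n = (cmod z)\<^sup>2"
  have n: "0 < 1 + n"
    by (simp add: n_def add_pos_nonneg)
  have "(norm (stereographic x))\<^sup>2 = (2 / (1 + n))\<^sup>2 * n + ((n - 1) / (1 + n))\<^sup>2"
    using n by (simp add: Finite_pt norm_Pair norm_mult norm_divide power_mult_distrib power_divide n_def del: of_real_add)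
  also have "\<dots> = 1"
    using n by (simp add: divide_simps) (simp add: power2_eq_square algebra_simps)
  finally show ?thesis
    by (simp add: power2_eq_1_iff) (smt (verit) norm_ge_zero)
qed (simp add: norm_Pair)

lemma stereographic_surj:
  assumes "norm v = 1"
  obtains x where "stereographic x = v"
proof (cases v)
  case (Pair \<zeta> h)
  have *: "(cmod \<zeta>)\<^sup>2 + h\<^sup>2 = 1"
    using assms by (simp add: Pair norm_Pair)
  show ?thesis
  proof (cases "h = 1")
    case True
    then show ?thesis
      using * that[of Infinity_pt] by (simp add: Pair)
  next
    case False
    define z where "z = \<zeta> / of_real (1 - h)"
    have "(cmod z)\<^sup>2 = (cmod \<zeta>)\<^sup>2 / (1 - h)\<^sup>2"
      by (simp add: z_def norm_divide power_divide del: of_real_diff)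
    also have "\<dots> = (1 + h) / (1 - h)"
    proof -
      have "(cmod \<zeta>)\<^sup>2 = (1 + h) * (1 - h)"
        using * by (simp add: power2_eq_square algebra_simps)
      then show ?thesis
        using False by (simp add: power2_eq_square)
    qed
    finally have n: "(cmod z)\<^sup>2 = (1 + h) / (1 - h)" .
    have n1: "1 + (cmod z)\<^sup>2 = 2 / (1 - h)" "(cmod z)\<^sup>2 - 1 = 2 * h / (1 - h)"
      unfolding n using False by (simp_all add: divide_simps)
    have "stereographic (Finite_pt z) = v"
      using False unfolding stereographic.simps n1 by (simp add: z_def Pair del: of_real_diff)
    then show ?thesis
      by (rule that)
  qed
qed

lemma inj_stereographic: "inj stereographic"
proof (rule injI)
  have fin: "snd (stereographic (Finite_pt z)) < 1" for z
    by (simp add: divide_simps add_pos_nonneg)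
  have "z = w" if eq: "stereographic (Finite_pt z) = stereographic (Finite_pt w)" for z w
  proof -
    have "1 + (cmod z)\<^sup>2 = 1 + (cmod w)\<^sup>2"
      using eq add_pos_nonneg[of 1 "(cmod z)\<^sup>2"] add_pos_nonneg[of 1 "(cmod w)\<^sup>2"]
      by (simp add: field_simps)
    moreover have "1 + (cmod w)\<^sup>2 \<noteq> 0"
      using add_pos_nonneg[of 1 "(cmod w)\<^sup>2"] by simp
    ultimately show ?thesis
      using eq by (simp del: of_real_add)
  qed
  then show "x = y" if "stereographic x = stereographic y" for x y
    using that fin by (cases x; cases y) (metis stereographic.simps(2) snd_conv less_irrefl)+
qed

lemma spherically_convex_cone2:
  assumes \<Omega>: "spherically_convex \<Omega>" and a: "a \<in> \<Omega>" and b: "b \<in> \<Omega>" and ab: "\<not> antipodal a b"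
    and st: "0 \<le> s" "0 \<le> t" and c: "stereographic c = s *\<^sub>R stereographic a + t *\<^sub>R stereographic b"
  shows "c \<in> \<Omega>"
proof -
  have "c \<in> spherical_geodesic a b"
    unfolding spherical_geodesic_def minor_arc_def using st c norm_stereographic[of c] by auto
  then show ?thesis
    using \<Omega> a b ab unfolding spherically_convex_def by blast
qed

text \<open>
  Let \<open>p\<close> and \<open>- p\<close> belong to the domain. Every other point \<open>x\<close> of the sphere lies on a great
  semicircle from \<open>p\<close> to \<open>- p\<close>. As the domain is open, it contains a point \<open>y\<close> of this semicircle
  close to \<open>p\<close>, and the minor arc from \<open>y\<close> to \<open>- p\<close> passes through \<open>x\<close>.
\<close>
lemma spherically_convex_antipodal_imp_UNIV:
  assumes \<Omega>: "spherically_convex \<Omega>" and a: "a \<in> \<Omega>" and b: "b \<in> \<Omega>" and ab: "antipodal a b"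
  shows "\<Omega> = UNIV"
proof (intro equalityI subset_UNIV subsetI)
  fix x
  let ?p = "stereographic a"
  define X where "X = stereographic x"
  have sb: "stereographic b = - ?p"
    using ab by (simp add: antipodal_def)
  show "x \<in> \<Omega>"
  proof (cases "x = a \<or> x = b")
    case True
    then show ?thesis using a b by auto
  next
    case False
    then have neq: "X \<noteq> ?p" "X \<noteq> - ?p"
      using inj_stereographic sb unfolding X_def inj_def by metis+
    have nX: "norm X = 1" "norm ?p = 1"
      by (simp_all add: X_def norm_stereographic)
    define y where "y e = (1 / norm (?p + e *\<^sub>R X)) *\<^sub>R (?p + e *\<^sub>R X)" for e
    have "openin (top_of_set (sphere 0 1)) (stereographic ` \<Omega>)"
      using \<Omega> by (simp add: spherically_convex_def sphere_domain_def)
    then obtain T where T: "open T" "stereographic ` \<Omega> = sphere 0 1 \<inter> T"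
      by (auto simp: openin_open)
    have "(y \<longlongrightarrow> (1 / norm (?p + 0 *\<^sub>R X)) *\<^sub>R (?p + 0 *\<^sub>R X)) (at_right 0)"
      unfolding y_def using nX by (intro tendsto_intros) auto
    then have "(y \<longlongrightarrow> ?p) (at_right 0)"
      using nX by simp
    moreover have "?p \<in> T"
      using a T by auto
    ultimately have "eventually (\<lambda>e. y e \<in> T) (at_right 0)"
      using T(1) by (intro topological_tendstoD)
    moreover have "eventually (\<lambda>e::real. e \<in> {0<..<1}) (at_right 0)"
      by (rule eventually_at_right_real) simp
    ultimately have "eventually (\<lambda>e. y e \<in> T \<and> e \<in> {0<..<1}) (at_right 0)"
      by (rule eventually_conj)
    then obtain e where e: "y e \<in> T" "0 < e" "e < 1"
      using eventually_happens'[OF trivial_limit_at_right_real] by fastforce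
    define N where "N = norm (?p + e *\<^sub>R X)"
    have "?p + e *\<^sub>R X \<noteq> 0"
    proof
      assume "?p + e *\<^sub>R X = 0"
      then have "norm ?p = norm (e *\<^sub>R X)"
        by (metis add_eq_0_iff norm_minus_cancel)
      then show False using nX e by simp
    qed
    then have N: "0 < N"
      by (simp add: N_def)
    have "norm (y e) = 1"
      using N by (simp add: y_def N_def)
    then obtain c where c: "c \<in> \<Omega>" "stereographic c = y e"
      using T(2) e(1) by (metis IntI imageE mem_sphere_0)
    have Np: "N *\<^sub>R y e = ?p + e *\<^sub>R X"
      using N by (simp add: y_def N_def)
    have "\<not> antipodal c b"
    proof
      assume "antipodal c b"
      then have "y e = ?p"
        using c sb by (simp add: antipodal_def)
      then have "(N - 1) *\<^sub>R ?p = e *\<^sub>R X"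
        using Np by (simp add: algebra_simps)
      then have X: "X = ((N - 1) / e) *\<^sub>R ?p"
        using e by (metis divide_inverse_commute left_inverse less_irrefl scaleR_one scaleR_scaleR)
      then have "\<bar>(N - 1) / e\<bar> = 1"
        using nX by (metis mult.right_neutral norm_scaleR)
      then have "(N - 1) / e = 1 \<or> (N - 1) / e = - 1"
        by linarith
      then show False
        using X neq by auto
    qed
    moreover have "stereographic x = (N / e) *\<^sub>R stereographic c + (1 / e) *\<^sub>R stereographic b"
    proof -
      have "(N / e) *\<^sub>R y e = (1 / e) *\<^sub>R (?p + e *\<^sub>R X)"
        unfolding Np[symmetric] by simp
      then show ?thesis
        using e by (simp add: c sb X_def algebra_simps)
    qed
    ultimately show ?thesis
      using N e by (intro spherically_convex_cone2[OF \<Omega> c(1) b]) auto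
  qed
qed

text \<open>
  The spherical triangle with vertices \<open>a\<close>, \<open>b\<close> and \<open>c\<close> consists of the minor arcs from \<open>c\<close> to the
  points of the minor arc from \<open>a\<close> to \<open>b\<close>.
\<close>
lemma spherically_convex_cone3:
  assumes \<Omega>: "spherically_convex \<Omega>" and na: "\<And>a b. a \<in> \<Omega> \<Longrightarrow> b \<in> \<Omega> \<Longrightarrow> \<not> antipodal a b"
    and abc: "a \<in> \<Omega>" "b \<in> \<Omega>" "c \<in> \<Omega>" and stu: "0 \<le> s" "0 \<le> t" "0 \<le> u"
    and d: "stereographic d = s *\<^sub>R stereographic a + t *\<^sub>R stereographic b + u *\<^sub>R stereographic c"
  shows "d \<in> \<Omega>"
proof (cases "s *\<^sub>R stereographic a + t *\<^sub>R stereographic b = 0")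
  case True
  then have "stereographic d = u *\<^sub>R stereographic c + 0 *\<^sub>R stereographic c"
    using d by simp
  then show ?thesis
    using spherically_convex_cone2[OF \<Omega> abc(3,3) na] abc stu by blast
next
  case False
  define v where "v = s *\<^sub>R stereographic a + t *\<^sub>R stereographic b"
  have "norm ((1 / norm v) *\<^sub>R v) = 1"
    using False by (simp add: v_def)
  then obtain e where e: "stereographic e = (1 / norm v) *\<^sub>R v"
    by (rule stereographic_surj)
  have "e \<in> \<Omega>"
    by (rule spherically_convex_cone2[OF \<Omega> abc(1,2) na, of "s / norm v" "t / norm v"])
       (use abc stu in \<open>auto simp: e v_def scaleR_add_right\<close>)
  moreover have "stereographic d = norm v *\<^sub>R stereographic e + u *\<^sub>R stereographic c"
    using d False by (simp add: e v_def)
  ultimately show ?thesis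
    using spherically_convex_cone2[OF \<Omega> _ abc(3) na] abc stu norm_ge_zero by blast
qed

text \<open>
  Multiplied by \<open>1 + |z|\<^sup>2\<close>, the stereographic image of \<open>z\<close> becomes \<open>(2 z, |z|\<^sup>2 - 1)\<close>. This is affine in
  \<open>z\<close> except for \<open>|z|\<^sup>2\<close>, which is convex, so along a chord it differs from its affine interpolation
  by a multiple \<open>u \<ge> 0\<close> of the south pole \<open>(0, - 1)\<close>, the image of \<open>0\<close>.
\<close>
lemma stereographic_segment:
  assumes "0 \<le> s" "0 \<le> t" "s + t = 1"
  obtains p q u where "0 \<le> p" "0 \<le> q" "0 \<le> u"
    "stereographic (Finite_pt (s *\<^sub>R a + t *\<^sub>R b)) =
      p *\<^sub>R stereographic (Finite_pt a) + q *\<^sub>R stereographic (Finite_pt b) + u *\<^sub>R stereographic (Finite_pt 0)"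
proof -
  define P where "P = s *\<^sub>R a + t *\<^sub>R b"
  define n where "n z = 1 + (cmod z)\<^sup>2" for z
  have n: "0 < n z" for z
    by (simp add: n_def add_pos_nonneg)
  define u where "u = (s * n a + t * n b - n P)"
  have st: "n z *\<^sub>R stereographic (Finite_pt z) = (2 * z, n z - 2)" for z
    using n[of z] by (simp add: n_def scaleR_conv_of_real del: of_real_add)
  have t: "t = 1 - s"
    using assms by simp
  have "u = s * t * (cmod (a - b))\<^sup>2"
    unfolding u_def n_def P_def t cmod_power2 by (simp add: power2_eq_square algebra_simps)
  then have u: "0 \<le> u"
    using assms by simp
  have "n P *\<^sub>R stereographic (Finite_pt P) = (s * n a) *\<^sub>R stereographic (Finite_pt a)
     + (t * n b) *\<^sub>R stereographic (Finite_pt b) + u *\<^sub>R stereographic (Finite_pt 0)"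
    unfolding scaleR_scaleR[symmetric] st
    by (simp add: P_def t u_def scaleR_conv_of_real algebra_simps)
  from arg_cong[OF this, of "\<lambda>v. (1 / n P) *\<^sub>R v"] have
    "stereographic (Finite_pt P) = (s * n a / n P) *\<^sub>R stereographic (Finite_pt a)
     + (t * n b / n P) *\<^sub>R stereographic (Finite_pt b) + (u / n P) *\<^sub>R stereographic (Finite_pt 0)"
    using n[of P] by (simp only: scaleR_add_right scaleR_scaleR) simp
  then show ?thesis
    using assms u n[THEN less_imp_le] unfolding P_def
    by (elim that[rotated 3]) (intro divide_nonneg_nonneg mult_nonneg_nonneg; assumption)+
qed

section \<open>Rotations of the Riemann sphere\<close>

text \<open>
  The point with homogeneous coordinates \<open>(z : w)\<close>. In these coordinates the value at \<open>\<infinity>\<close> and the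
  pole of a Moebius transformation need no separate treatment.
\<close>
definition homog :: "complex \<Rightarrow> complex \<Rightarrow> riemann_sphere" where
  "homog z w = (if w = 0 then Infinity_pt else Finite_pt (z / w))"

lemma stereographic_homog:
  assumes "z \<noteq> 0 \<or> w \<noteq> 0"
  shows "stereographic (homog z w) =
    (1 / ((cmod z)\<^sup>2 + (cmod w)\<^sup>2)) *\<^sub>R (2 * z * cnj w, (cmod z)\<^sup>2 - (cmod w)\<^sup>2)"
proof (cases "w = 0")
  case True
  then show ?thesis
    using assms by (simp add: homog_def)
next
  case False
  define n m where "n = (cmod z)\<^sup>2" and "m = (cmod w)\<^sup>2"
  have m: "0 < m" "0 \<le> n"
    using False by (auto simp: m_def n_def)
  have wm: "w * cnj w = of_real m"
    by (simp add: m_def complex_norm_square flip: of_real_power)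
  have e: "(cmod (z / w))\<^sup>2 = n / m"
    by (simp add: n_def m_def norm_divide power_divide)
  have "1 + n / m = (n + m) / m" "n / m - 1 = (n - m) / m"
    using m by (simp_all add: field_simps)
  moreover have "z / w = z * cnj w / of_real m"
    using False by (simp flip: wm)
  ultimately have "stereographic (Finite_pt (z / w)) = (2 / of_real ((n + m) / m) * (z * cnj w / of_real m), (n - m) / m / ((n + m) / m))"
    unfolding stereographic.simps e by simp
  also have "\<dots> = (1 / (n + m)) *\<^sub>R (2 * z * cnj w, n - m)"
    using m by (simp add: scaleR_conv_of_real del: of_real_add)
  finally show ?thesis
    using False by (simp add: homog_def n_def m_def)
qed

text \<open>
  The Moebius transformation of the matrix with rows \<open>(\<alpha>, \<beta>)\<close> and \<open>(- cnj \<beta>, \<alpha>)\<close>, which is in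
  \<open>SU(2)\<close> if \<open>\<alpha>\<^sup>2 + |\<beta>|\<^sup>2 = 1\<close>. Matrices with a real entry \<open>\<alpha>\<close> suffice to move an arbitrary point
  to \<open>0\<close>.
\<close>
fun rotation :: "real \<Rightarrow> complex \<Rightarrow> riemann_sphere \<Rightarrow> riemann_sphere" where
  "rotation \<alpha> \<beta> (Finite_pt w) = homog (\<alpha> * w + \<beta>) (\<alpha> - cnj \<beta> * w)"
| "rotation \<alpha> \<beta> Infinity_pt = homog \<alpha> (- cnj \<beta>)"

text \<open>
  The linear map of space by which such a transformation acts on the unit sphere, that is, the image
  of the matrix under the double covering of \<open>SO(3)\<close> by \<open>SU(2)\<close>.
\<close>
definition rotation3 :: "real \<Rightarrow> complex \<Rightarrow> complex \<times> real \<Rightarrow> complex \<times> real" where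
  "rotation3 \<alpha> \<beta> v = (of_real (\<alpha>\<^sup>2) * fst v - \<beta>\<^sup>2 * cnj (fst v) - of_real (2 * \<alpha> * snd v) * \<beta>,
     (\<alpha>\<^sup>2 - (cmod \<beta>)\<^sup>2) * snd v + 2 * \<alpha> * Re (cnj \<beta> * fst v))"

lemma linear_rotation3: "linear (rotation3 \<alpha> \<beta>)"
  by (rule linearI) (auto simp: rotation3_def scaleR_conv_of_real algebra_simps)

lemma norm_rotation3:
  assumes "\<alpha>\<^sup>2 + (cmod \<beta>)\<^sup>2 = 1"
  shows "norm (rotation3 \<alpha> \<beta> v) = norm v"
proof -
  obtain a b where \<beta>: "\<beta> = Complex a b" by (cases \<beta>)
  obtain x y h where v: "v = (Complex x y, h)" by (cases v, cases "fst v") auto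
  have norm2: "(norm u)\<^sup>2 = (Re (fst u))\<^sup>2 + (Im (fst u))\<^sup>2 + (snd u)\<^sup>2" for u :: "complex \<times> real"
    by (simp add: norm_prod_def cmod_power2)
  have "(norm (rotation3 \<alpha> \<beta> v))\<^sup>2 = (\<alpha>\<^sup>2 + (cmod \<beta>)\<^sup>2)\<^sup>2 * (norm v)\<^sup>2"
    unfolding norm2 rotation3_def cmod_power2 by (simp add:  \<beta> v power2_eq_square) algebra
  then show ?thesis
    using assms by simp
qed

lemma rotation3_homog:
  assumes "\<alpha>\<^sup>2 + (cmod \<beta>)\<^sup>2 = 1" and zw: "z \<noteq> 0 \<or> w \<noteq> 0"
  shows "rotation3 \<alpha> \<beta> (stereographic (homog z w)) =
    stereographic (homog (\<alpha> * z + \<beta> * w) (\<alpha> * w - cnj \<beta> * z))"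
proof -
  let ?z = "\<alpha> * z + \<beta> * w" and ?w = "\<alpha> * w - cnj \<beta> * z"
  obtain a b where \<beta>: "\<beta> = Complex a b" by (cases \<beta>)
  obtain x y where z: "z = Complex x y" by (cases z)
  obtain p q where w: "w = Complex p q" by (cases w)
  have "(cmod ?z)\<^sup>2 + (cmod ?w)\<^sup>2 = (\<alpha>\<^sup>2 + (cmod \<beta>)\<^sup>2) * ((cmod z)\<^sup>2 + (cmod w)\<^sup>2)"
    unfolding cmod_power2 by (simp add: \<beta> z w power2_eq_square) algebra
  then have n: "(cmod ?z)\<^sup>2 + (cmod ?w)\<^sup>2 = (cmod z)\<^sup>2 + (cmod w)\<^sup>2"
    using assms by simp
  then have "?z \<noteq> 0 \<or> ?w \<noteq> 0"
    using zw by (metis add_0 add_nonneg_eq_0_iff norm_eq_zero power2_eq_square zero_eq_power2 zero_le_power2)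
  moreover have "rotation3 \<alpha> \<beta> (2 * z * cnj w, (cmod z)\<^sup>2 - (cmod w)\<^sup>2) = (2 * ?z * cnj ?w, (cmod ?z)\<^sup>2 - (cmod ?w)\<^sup>2)"
    unfolding rotation3_def cmod_power2 by (simp add: \<beta> z w cmod_power2 power2_eq_square complex_eq_iff algebra_simps)
  ultimately show ?thesis
    using zw by (simp only: stereographic_homog linear_scale[OF linear_rotation3] n)
qed

lemma stereographic_rotation:
  assumes "\<alpha>\<^sup>2 + (cmod \<beta>)\<^sup>2 = 1"
  shows "stereographic (rotation \<alpha> \<beta> x) = rotation3 \<alpha> \<beta> (stereographic x)"
proof (cases x)
  case (Finite_pt w)
  then show ?thesis
    using rotation3_homog[OF assms, of w 1] by (simp add: homog_def)
next
  case Infinity_pt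
  then show ?thesis
    using rotation3_homog[OF assms, of 1 0] by (simp add: homog_def)
qed

lemma inj_rotation:
  assumes "\<alpha>\<^sup>2 + (cmod \<beta>)\<^sup>2 = 1"
  shows "inj (rotation \<alpha> \<beta>)"
proof (rule injI)
  fix x y assume "rotation \<alpha> \<beta> x = rotation \<alpha> \<beta> y"
  then have "rotation3 \<alpha> \<beta> (stereographic x - stereographic y) = 0"
    using stereographic_rotation[OF assms] linear_diff[OF linear_rotation3] by (metis diff_self)
  then have "stereographic x = stereographic y"
    using norm_rotation3[OF assms] by (metis eq_iff_diff_eq_0 norm_eq_zero)
  then show "x = y"
    using inj_stereographic by (simp add: inj_def)
qed

lemma rotation_to_zero:
  obtains \<alpha> \<beta> where "\<alpha>\<^sup>2 + (cmod \<beta>)\<^sup>2 = 1" "rotation \<alpha> \<beta> x = Finite_pt 0"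
proof (cases x)
  case (Finite_pt a)
  define \<alpha> where "\<alpha> = 1 / sqrt (1 + (cmod a)\<^sup>2)"
  define \<beta> where "\<beta> = - a * of_real \<alpha>"
  have pos: "0 < 1 + (cmod a)\<^sup>2"
    by (simp add: add_pos_nonneg)
  have \<alpha>: "0 < \<alpha>" "\<alpha>\<^sup>2 = 1 / (1 + (cmod a)\<^sup>2)"
    using pos by (simp_all add: \<alpha>_def power_divide)
  have "\<alpha>\<^sup>2 + (cmod \<beta>)\<^sup>2 = \<alpha>\<^sup>2 * (1 + (cmod a)\<^sup>2)"
    by (simp add: \<beta>_def norm_mult power_mult_distrib algebra_simps)
  then have 1: "\<alpha>\<^sup>2 + (cmod \<beta>)\<^sup>2 = 1"
    using pos by (simp add: \<alpha>(2))
  have "of_real \<alpha> - cnj \<beta> * a = of_real (\<alpha> * (1 + (cmod a)\<^sup>2))"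
    by (simp add: \<beta>_def complex_norm_square algebra_simps flip: of_real_power)
  also have "\<dots> \<noteq> 0"
    using \<alpha> pos by (metis mult_eq_0_iff of_real_eq_0_iff less_irrefl)
  finally have "rotation \<alpha> \<beta> x = Finite_pt 0"
    by (simp add: Finite_pt homog_def \<beta>_def)
  then show ?thesis
    using 1 by (rule that[rotated])
next
  case Infinity_pt
  show ?thesis
    by (rule that[of 0 1]) (simp_all add: Infinity_pt homog_def)
qed

text \<open>
  A rotation preserves antipodal pairs, and the antipode of \<open>0\<close> is \<open>\<infinity>\<close>.
\<close>
lemma rotation_neq_Infinity:
  assumes "\<alpha>\<^sup>2 + (cmod \<beta>)\<^sup>2 = 1" "rotation \<alpha> \<beta> a = Finite_pt 0" "\<not> antipodal a b"
  shows "rotation \<alpha> \<beta> b \<noteq> Infinity_pt"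
proof
  assume "rotation \<alpha> \<beta> b = Infinity_pt"
  then have "rotation3 \<alpha> \<beta> (stereographic b) = (0, 1)" "rotation3 \<alpha> \<beta> (stereographic a) = (0, - 1)"
    using stereographic_rotation[OF assms(1)] assms(2) by (metis stereographic.simps(2), force dest: arg_cong[of _ _ stereographic] simp flip: stereographic_rotation[OF assms(1)])
  then have "rotation3 \<alpha> \<beta> (stereographic b + stereographic a) = 0"
    by (simp add: linear_add[OF linear_rotation3] zero_prod_def)
  then have "stereographic b + stereographic a = 0"
    using norm_rotation3[OF assms(1)] by (metis norm_eq_zero)
  then show False
    using assms(3) by (simp add: antipodal_def eq_neg_iff_add_eq_0)
qed

text \<open>
  The point \<open>0\<close> has to be in the rotated domain since a Euclidean segment is not a spherical
  geodesic: it only lies in the spherical triangle that its end points form with \<open>0\<close>.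
\<close>
lemma convex_rotated_domain:
  assumes \<Omega>: "spherically_convex \<Omega>" and na: "\<And>a b. a \<in> \<Omega> \<Longrightarrow> b \<in> \<Omega> \<Longrightarrow> \<not> antipodal a b"
    and \<alpha>\<beta>: "\<alpha>\<^sup>2 + (cmod \<beta>)\<^sup>2 = 1" and 0: "Finite_pt 0 \<in> rotation \<alpha> \<beta> ` \<Omega>"
  shows "convex {w. Finite_pt w \<in> rotation \<alpha> \<beta> ` \<Omega>}"
proof (rule convexI, unfold mem_Collect_eq)
  fix A B and s t :: real
  assume AB: "Finite_pt A \<in> rotation \<alpha> \<beta> ` \<Omega>" "Finite_pt B \<in> rotation \<alpha> \<beta> ` \<Omega>"
    and st: "0 \<le> s" "0 \<le> t" "s + t = 1"
  let ?P = "Finite_pt (s *\<^sub>R A + t *\<^sub>R B)"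
  obtain a b o' where abo: "a \<in> \<Omega>" "b \<in> \<Omega>" "o' \<in> \<Omega>" "rotation \<alpha> \<beta> a = Finite_pt A"
    "rotation \<alpha> \<beta> b = Finite_pt B" "rotation \<alpha> \<beta> o' = Finite_pt 0"
    using AB 0 by (elim imageE) simp
  obtain p q u where pqu: "0 \<le> p" "0 \<le> q" "0 \<le> u" and P: "stereographic ?P =
      p *\<^sub>R stereographic (Finite_pt A) + q *\<^sub>R stereographic (Finite_pt B) + u *\<^sub>R stereographic (Finite_pt 0)"
    by (rule stereographic_segment[OF st])
  define v where "v = p *\<^sub>R stereographic a + q *\<^sub>R stereographic b + u *\<^sub>R stereographic o'"
  have v: "rotation3 \<alpha> \<beta> v = stereographic ?P"
    unfolding v_def P abo(4-6)[symmetric] stereographic_rotation[OF \<alpha>\<beta>]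
    by (simp only: linear_add[OF linear_rotation3] linear_scale[OF linear_rotation3])
  then have "norm v = 1"
    using norm_rotation3[OF \<alpha>\<beta>] norm_stereographic by metis
  then obtain d where d: "stereographic d = v"
    by (rule stereographic_surj)
  have "d \<in> \<Omega>"
    using spherically_convex_cone3[OF \<Omega> na abo(1-3) pqu] d v_def by blast
  moreover have "rotation \<alpha> \<beta> d = ?P"
    using v d stereographic_rotation[OF \<alpha>\<beta>] inj_stereographic by (metis injD)
  ultimately show "?P \<in> rotation \<alpha> \<beta> ` \<Omega>"
    by (metis imageI)
qed

section \<open>The rotated function\<close>

text \<open>
  If \<open>f\<close> were onto the sphere, it would have exactly one pole. Off the pole it would be a bijection
  onto the plane, and its inverse a bounded entire function that is not constant.
\<close>
lemma sphere_map_disc_not_surj: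
  assumes f: "f nicely_meromorphic_on ball 0 1" and inj: "inj_on (sphere_map f) (ball 0 1)"
  shows "sphere_map f ` ball 0 1 \<noteq> UNIV"
proof
  let ?D = "ball (0::complex) 1"
  assume surj: "sphere_map f ` ?D = UNIV"
  then obtain z0 where z0: "z0 \<in> ?D" "sphere_map f z0 = Infinity_pt"
    by (metis UNIV_I imageE)
  define S where "S = ?D - {z0}"
  have S: "open S"
    by (simp add: S_def open_delete)
  have np: "\<not> is_pole f z" if "z \<in> S" for z
    using that inj z0 by (auto simp: S_def sphere_map_def inj_on_def split: if_splits)
  have fS: "sphere_map f z = Finite_pt (f z)" if "z \<in> S" for z
    using np[OF that] by (simp add: sphere_map_def)
  have hol: "f holomorphic_on S"
    using nicely_meromorphic_on_imp_analytic_at[OF f _ np]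
    by (intro analytic_imp_holomorphic) (subst analytic_on_analytic_at, auto simp: S_def)
  have injS: "inj_on f S"
    using inj fS by (auto simp: inj_on_def S_def)
  obtain k where k: "k holomorphic_on f ` S" "\<And>z. z \<in> S \<Longrightarrow> k (f z) = z"
    using holomorphic_has_inverse[OF hol S injS] by metis
  have UNIV: "f ` S = UNIV"
  proof (intro equalityI subset_UNIV subsetI)
    fix w
    obtain z where z: "z \<in> ?D" "sphere_map f z = Finite_pt w"
      using surj by (metis UNIV_I imageE)
    then have "z \<in> S"
      using z0 by (auto simp: S_def)
    then show "w \<in> f ` S"
      using z(2) fS by auto
  qed
  have kS: "k w \<in> S" for w
    using UNIV k(2) by (metis UNIV_I imageE)
  then have "bounded (range k)"
    by (intro bounded_subset[OF bounded_ball[of 0 1]]) (auto simp: S_def)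
  then have "k constant_on UNIV"
    using Liouville_theorem k(1) UNIV by simp
  then have const: "z = z'" if "z \<in> S" "z' \<in> S" for z z'
    using that k(2) by (metis UNIV_I constant_on_def)
  have "infinite ?D"
    using uncountable_ball[of 1 "0::complex"] countable_finite by auto
  then have "infinite S"
    by (simp add: S_def)
  then obtain a where "a \<in> S" by fastforce
  then have "S = {a}" using const by blast
  with \<open>infinite S\<close> show False by simp
qed

text \<open>
  At a pole of \<open>f\<close> the value is that of the Moebius transformation at \<open>\<infinity>\<close>, so that the function
  extends holomorphically over the poles as long as its image avoids \<open>\<infinity>\<close>.
\<close>
definition rotated :: "real \<Rightarrow> complex \<Rightarrow> (complex \<Rightarrow> complex) \<Rightarrow> complex \<Rightarrow> complex" where
  "rotated \<alpha> \<beta> f z =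
     (if is_pole f z then - of_real \<alpha> / cnj \<beta> else (\<alpha> * f z + \<beta>) / (\<alpha> - cnj \<beta> * f z))"

lemma rotation_sphere_map:
  assumes "rotation \<alpha> \<beta> (sphere_map f z) \<noteq> Infinity_pt"
  shows "rotation \<alpha> \<beta> (sphere_map f z) = Finite_pt (rotated \<alpha> \<beta> f z)"
proof (cases "is_pole f z")
  case True
  then show ?thesis
    using assms by (cases "\<beta> = 0") (simp_all add: sphere_map_def rotated_def homog_def)
next
  case False
  then show ?thesis
    using assms
    unfolding sphere_map_def rotated_def if_not_P[OF False] rotation.simps homog_def by metis
qed

text \<open>
  At most one point of the disc is a pole of \<open>f\<close>. There the rotated function is continuous, so the
  singularity is removable. Off the pole the second claim is the invariance of the spherical metric
  under rotations; at the pole it follows by continuity of the right-hand side, the value on the left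
  being a limit.
\<close>
lemma
  assumes f: "f nicely_meromorphic_on ball 0 1" and inj: "inj_on (sphere_map f) (ball 0 1)"
    and \<alpha>\<beta>: "\<alpha>\<^sup>2 + (cmod \<beta>)\<^sup>2 = 1"
    and fin: "\<And>z. z \<in> ball 0 1 \<Longrightarrow> rotation \<alpha> \<beta> (sphere_map f z) \<noteq> Infinity_pt"
  shows holomorphic_rotated: "rotated \<alpha> \<beta> f holomorphic_on ball 0 1"
    and spherical_deriv_rotated: "\<And>z. z \<in> ball 0 1 \<Longrightarrow> spherical_deriv f z =
      cmod (deriv (rotated \<alpha> \<beta> f) z) / (1 + (cmod (rotated \<alpha> \<beta> f z))\<^sup>2)"
proof -
  let ?D = "ball (0::complex) 1"
  define g where "g = rotated \<alpha> \<beta> f"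
  define K where "K = {z \<in> ?D. is_pole f z}"
  define H where "H z = cmod (deriv g z) / (1 + (cmod (g z))\<^sup>2)" for z
  have K: "K \<subseteq> {z}" if "z \<in> K" for z
    using that inj by (auto simp: K_def inj_on_def sphere_map_def)
  then have "finite K"
    by (metis finite.emptyI finite.insertI finite_subset ex_in_conv)
  then have "open (?D - K)"
    by (simp add: open_Diff finite_imp_closed)
  have den: "of_real \<alpha> - cnj \<beta> * f z \<noteq> 0" if "z \<in> ?D - K" for z
    using fin[of z] that by (auto simp: K_def sphere_map_def homog_def)
  have fK: "f holomorphic_on ?D - K"
    using nicely_meromorphic_on_imp_analytic_at[OF f]
    by (intro analytic_imp_holomorphic) (subst analytic_on_analytic_at, auto simp: K_def)
  have g_eq: "g z = (\<alpha> * f z + \<beta>) / (\<alpha> - cnj \<beta> * f z)" if "z \<in> ?D - K" for z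
    using that by (auto simp: g_def rotated_def K_def)
  have near: "eventually (\<lambda>w. w \<in> ?D - K) (at z)" if "z \<in> ?D" for z
  proof -
    have "eventually (\<lambda>w. w \<in> ?D - (K - {z})) (at z)"
      using that \<open>finite K\<close> by (intro eventually_at_in_open' open_Diff finite_imp_closed) auto
    moreover have "eventually (\<lambda>w. w \<noteq> z) (at z)"
      by (simp add: eventually_at_filter)
    ultimately show ?thesis
      by eventually_elim auto
  qed
  have gK: "g holomorphic_on ?D - K"
  proof -
    have "(\<lambda>z. (\<alpha> * f z + \<beta>) / (\<alpha> - cnj \<beta> * f z)) holomorphic_on ?D - K"
      using den by (intro holomorphic_intros fK) auto
    then show ?thesis
      by (rule holomorphic_transform) (simp add: g_eq)
  qed
  have hol: "g holomorphic_on ?D"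
  proof (rule no_isolated_singularity'[OF _ gK _ \<open>finite K\<close>])
    fix z assume z: "z \<in> K"
    then have zD: "z \<in> ?D" and pole: "is_pole f z"
      by (simp_all add: K_def)
    then have \<beta>: "\<beta> \<noteq> 0"
      using fin[of z] by (auto simp: sphere_map_def homog_def)
    have lim: "filterlim f at_infinity (at z)"
      using pole by (simp add: is_pole_def)
    then have inv: "((\<lambda>w. inverse (f w)) \<longlongrightarrow> 0) (at z)"
      by (rule filterlim_compose[OF tendsto_inverse_0])
    have "((\<lambda>w. (\<alpha> + \<beta> * inverse (f w)) / (\<alpha> * inverse (f w) - cnj \<beta>)) \<longlongrightarrow>
        (\<alpha> + \<beta> * 0) / (of_real \<alpha> * 0 - cnj \<beta>)) (at z)"
      using \<beta> by (intro tendsto_divide tendsto_add tendsto_diff tendsto_mult tendsto_const inv) auto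
    moreover have "eventually (\<lambda>w. f w \<noteq> 0) (at z)"
      using filterlim_at_infinity_imp_eventually_ne[OF lim] .
    with near[OF zD] have "eventually (\<lambda>w. (\<alpha> + \<beta> * inverse (f w)) / (\<alpha> * inverse (f w) - cnj \<beta>) = g w) (at z)"
    proof eventually_elim
      case (elim w)
      then have "(\<alpha> + \<beta> * inverse (f w)) / (\<alpha> * inverse (f w) - cnj \<beta>) =
          ((\<alpha> + \<beta> * inverse (f w)) * f w) / ((\<alpha> * inverse (f w) - cnj \<beta>) * f w)"
        by simp
      also have "\<dots> = g w"
        using elim unfolding g_eq[OF elim(1)] by (simp add: algebra_simps)
      finally show ?case .
    qed
    ultimately have "(g \<longlongrightarrow> (\<alpha> + \<beta> * 0) / (of_real \<alpha> * 0 - cnj \<beta>)) (at z)"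
      by (blast intro: Lim_transform_eventually)
    moreover have "(\<alpha> + \<beta> * 0) / (of_real \<alpha> * 0 - cnj \<beta>) = g z"
      using pole by (simp add: g_def rotated_def)
    ultimately show "(g \<longlongrightarrow> g z) (at z within ?D)"
      using at_within_open[OF zD open_ball] by simp
  qed simp
  then show "rotated \<alpha> \<beta> f holomorphic_on ?D"
    by (simp add: g_def)
  have regular: "cmod (deriv f z) / (1 + (cmod (f z))\<^sup>2) = H z" if z: "z \<in> ?D - K" for z
  proof -
    let ?d = "of_real \<alpha> - cnj \<beta> * f z"
    have d: "?d \<noteq> 0"
      using den[OF z] .
    have unit: "of_real \<alpha> * of_real \<alpha> + \<beta> * cnj \<beta> = 1"
      using arg_cong[OF \<alpha>\<beta>, of complex_of_real]
      unfolding of_real_add complex_norm_square by (simp add: power2_eq_square)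
    have f': "(f has_field_derivative deriv f z) (at z)"
      using holomorphic_derivI[OF fK \<open>open (?D - K)\<close> z] .
    have "((\<lambda>z. (\<alpha> * f z + \<beta>) / (\<alpha> - cnj \<beta> * f z)) has_field_derivative
        (\<alpha> * deriv f z * ?d - (\<alpha> * f z + \<beta>) * (- cnj \<beta> * deriv f z)) / (?d * ?d)) (at z)"
      using d by (auto intro!: derivative_eq_intros f')
    moreover have "\<alpha> * deriv f z * ?d - (\<alpha> * f z + \<beta>) * (- cnj \<beta> * deriv f z) =
        deriv f z * (of_real \<alpha> * of_real \<alpha> + \<beta> * cnj \<beta>)"
      by (simp add: algebra_simps)
    ultimately have "((\<lambda>z. (\<alpha> * f z + \<beta>) / (\<alpha> - cnj \<beta> * f z)) has_field_derivative deriv f z / ?d\<^sup>2) (at z)"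
      by (simp add: unit power2_eq_square)
    then have "(g has_field_derivative deriv f z / ?d\<^sup>2) (at z)"
      by (rule has_field_derivative_transform_within_open[OF _ \<open>open (?D - K)\<close> z]) (simp add: g_eq)
    then have g': "cmod (deriv g z) = cmod (deriv f z) / (cmod ?d)\<^sup>2"
      by (simp add: DERIV_imp_deriv norm_divide norm_power)
    have "(cmod (\<alpha> * f z + \<beta>))\<^sup>2 + (cmod ?d)\<^sup>2 = (\<alpha>\<^sup>2 + (cmod \<beta>)\<^sup>2) * (1 + (cmod (f z))\<^sup>2)"
      unfolding cmod_power2 by (simp add: power2_eq_square algebra_simps)
    then have "(cmod (\<alpha> * f z + \<beta>))\<^sup>2 + (cmod ?d)\<^sup>2 = 1 + (cmod (f z))\<^sup>2"
      using \<alpha>\<beta> by simp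
    then have "1 + (cmod (g z))\<^sup>2 = (1 + (cmod (f z))\<^sup>2) / (cmod ?d)\<^sup>2"
      using d by (simp add: g_eq[OF z] norm_divide power_divide field_simps)
    then show ?thesis
      using d by (simp add: H_def g')
  qed
  have "continuous_on ?D H"
    unfolding H_def
    by (intro continuous_intros holomorphic_on_imp_continuous_on holomorphic_deriv hol)
       (auto simp: add_nonneg_eq_0_iff)
  then have cont_H: "(H \<longlongrightarrow> H z) (at z)" if "z \<in> ?D" for z
    using that by (metis continuous_on_def at_within_open open_ball)
  show "spherical_deriv f z = cmod (deriv (rotated \<alpha> \<beta> f) z) / (1 + (cmod (rotated \<alpha> \<beta> f z))\<^sup>2)"
    if z: "z \<in> ?D" for z
  proof (cases "is_pole f z")
    case True
    have "((\<lambda>w. cmod (deriv f w) / (1 + (cmod (f w))\<^sup>2)) \<longlongrightarrow> H z) (at z)"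
      by (rule Lim_transform_eventually[OF cont_H[OF z]])
         (use near[OF z] in eventually_elim, simp add: regular)
    then show ?thesis
      using True tendsto_Lim[OF at_neq_bot] by (simp add: spherical_deriv_def H_def g_def)
  next
    case False
    then show ?thesis
      using regular[of z] z by (simp add: spherical_deriv_def K_def H_def g_def)
  qed
qed

section \<open>The length of the image of a circle\<close>

theorem mainTheorem6:
  fixes f :: "complex \<Rightarrow> complex"
  assumes "spherically_convex_fun f"
  shows "\<forall>r::real. 0 < r \<and> r < 1 \<longrightarrow>
    spherical_length f (circlepath 0 r) \<le> 2 * pi * r / (1 - r\<^sup>2) * spherical_deriv f 0"
proof (intro allI impI, elim conjE)
  fix r :: real
  assume r: "0 < r" "r < 1"
  let ?D = "ball (0::complex) 1" and ?\<gamma> = "circlepath 0 r"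
  define \<Omega> where "\<Omega> = sphere_map f ` ?D"
  have f: "f nicely_meromorphic_on ?D" and inj: "inj_on (sphere_map f) ?D"
    and \<Omega>: "spherically_convex \<Omega>"
    using assms by (auto simp: spherically_convex_fun_def \<Omega>_def)
  have na: "\<not> antipodal a b" if "a \<in> \<Omega>" "b \<in> \<Omega>" for a b
    using spherically_convex_antipodal_imp_UNIV[OF \<Omega> that] sphere_map_disc_not_surj[OF f inj]
    by (auto simp: \<Omega>_def)
  obtain \<alpha> \<beta> where \<alpha>\<beta>: "\<alpha>\<^sup>2 + (cmod \<beta>)\<^sup>2 = 1" and zero: "rotation \<alpha> \<beta> (sphere_map f 0) = Finite_pt 0"
    by (rule rotation_to_zero)
  have fin: "rotation \<alpha> \<beta> (sphere_map f z) \<noteq> Infinity_pt" if "z \<in> ?D" for z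
    using that by (intro rotation_neq_Infinity[OF \<alpha>\<beta> zero] na) (auto simp: \<Omega>_def)
  define g where "g = rotated \<alpha> \<beta> f"
  have hol: "g holomorphic_on ?D"
    unfolding g_def by (rule holomorphic_rotated[OF f inj \<alpha>\<beta> fin])
  have deriv_eq: "spherical_deriv f z = cmod (deriv g z) / (1 + (cmod (g z))\<^sup>2)" if "z \<in> ?D" for z
    unfolding g_def by (rule spherical_deriv_rotated[OF f inj \<alpha>\<beta> fin that])
  have g_eq: "rotation \<alpha> \<beta> (sphere_map f z) = Finite_pt (g z)" if "z \<in> ?D" for z
    unfolding g_def by (rule rotation_sphere_map[OF fin[OF that]])
  have g0: "g 0 = 0"
    using zero g_eq[of 0] by simp
  have inj_g: "inj_on g ?D"
    using inj inj_rotation[OF \<alpha>\<beta>] g_eq by (metis (no_types, lifting) inj_on_def injD)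
  have "{w. Finite_pt w \<in> rotation \<alpha> \<beta> ` \<Omega>} = g ` ?D"
    by (force simp: \<Omega>_def g_eq image_iff)
  moreover have "Finite_pt 0 \<in> rotation \<alpha> \<beta> ` \<Omega>"
    unfolding zero[symmetric] \<Omega>_def by (intro imageI) simp
  ultimately have conv: "convex (g ` ?D)"
    using convex_rotated_domain[OF \<Omega> na \<alpha>\<beta>] by simp
  have \<gamma>D: "?\<gamma> t \<in> ?D" for t
    using r by (simp add: circlepath norm_mult)
  have cont: "continuous_on {0..1} (\<lambda>t. h (?\<gamma> t))" if "continuous_on ?D h" for h :: "complex \<Rightarrow> real"
    using \<gamma>D path_circlepath[of 0 r] unfolding path_def
    by (intro continuous_on_compose2[OF that]) auto
  have cont_g': "continuous_on ?D (\<lambda>z. cmod (deriv g z))"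
    by (intro continuous_intros holomorphic_on_imp_continuous_on holomorphic_deriv hol) auto
  have "continuous_on ?D (\<lambda>z. cmod (deriv g z) / (1 + (cmod (g z))\<^sup>2))"
    by (intro continuous_intros cont_g' holomorphic_on_imp_continuous_on hol)
       (auto simp: add_nonneg_eq_0_iff)
  then have cont_f: "continuous_on ?D (spherical_deriv f)"
    by (rule continuous_on_eq) (simp add: deriv_eq)
  have "spherical_length f ?\<gamma> = integral {0..1} (\<lambda>t. 2 * pi * r * spherical_deriv f (?\<gamma> t))"
    unfolding spherical_length_def using r
    by (intro integral_cong) (simp add: vector_derivative_circlepath01 norm_mult)
  also have "\<dots> \<le> integral {0..1} (\<lambda>t. 2 * pi * r * cmod (deriv g (?\<gamma> t)))"
  proof (rule integral_le)
    show "(\<lambda>t. 2 * pi * r * spherical_deriv f (?\<gamma> t)) integrable_on {0..1}"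
      "(\<lambda>t. 2 * pi * r * cmod (deriv g (?\<gamma> t))) integrable_on {0..1}"
      by (intro integrable_continuous_real continuous_intros cont cont_f cont_g')+
    show "2 * pi * r * spherical_deriv f (?\<gamma> t) \<le> 2 * pi * r * cmod (deriv g (?\<gamma> t))" for t
      using r deriv_eq[OF \<gamma>D, of t]
      by (intro mult_left_mono) (simp_all add: divide_le_eq_1 field_simps add_pos_nonneg mult_nonneg_nonneg)
  qed
  also have "\<dots> = 2 * pi * r * integral {0..1} (\<lambda>t. cmod (deriv g (?\<gamma> t)))"
    by simp
  also have "\<dots> \<le> 2 * pi * r * (cmod (deriv g 0) / (1 - r\<^sup>2))"
  proof (rule mult_left_mono)
    have "0 < 1 - r\<^sup>2"
      using r by (simp add: power_less_one_iff abs_square_less_1)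
    then show "integral {0..1} (\<lambda>t. cmod (deriv g (?\<gamma> t))) \<le> cmod (deriv g 0) / (1 - r\<^sup>2)"
      using mean_norm_deriv_le_of_convex_image[OF hol inj_g conv r] by (simp add: field_simps)
  qed (use r in simp)
  also have "\<dots> = 2 * pi * r / (1 - r\<^sup>2) * spherical_deriv f 0"
    using deriv_eq[of 0] g0 by simp
  finally show "spherical_length f ?\<gamma> \<le> 2 * pi * r / (1 - r\<^sup>2) * spherical_deriv f 0" .
qed

end
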